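(* There is no algorithm that takes as input a Turing machine enumerating a family $\mathcal A$ of finite simple graphs and decides whether $\mathcal A$ is $K_3$-abundant.
   Context: A Turing machine enumerates a family $\mathcal A$ of finite graphs if it outputs every member of $\mathcal A$, possibly more than once, and outputs no graph outside $\mathcal A$. An embedding of $H$ into $G$ is an injective edge-preserving map $V(H)\to V(G)$ (not necessarily induced), and $\mathrm{Emb}(H,G)$ is the number of embeddings; $v(H)=|V(H)|$. An $n$-vertex graph $G$ is $\varepsilon$-far from being $K_3$-free if at least $\varepsilon n^2$ edges must be deleted from $G$ to make it triangle-free. A possibly infinite family $\mathcal A$ of finite simple graphs is $K_3$-abundant if there are constants $c,C>0$ such that, for every $0<\varepsilon\le1$, there is $n_0(\varepsilon)$ for which every $n$-vertex graph $G$ with $n\ge n_0(\varepsilon)$ that is $\varepsilon$-far from being $K_3$-free admits some $H\in\mathcal A$ (possibly depending on $G$ and $\varepsilon$) satisfying $\mathrm{Emb}(H,G)\ge c\varepsilon^Cn^{v(H)}$. *)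

theory Defs
  imports Complex_Main "HOL-Library.FuncSet"
begin

section \<open>Finite simple graphs and abundance\<close>

record 'v graph =
  verts :: "'v set"
  edges :: "'v set set"

definition finite_simple_graph :: "'v graph \<Rightarrow> bool" where
  "finite_simple_graph G \<longleftrightarrow>
     finite (verts G) \<and> edges G \<subseteq> {e. e \<subseteq> verts G \<and> card e = 2}"

definition triangle_free :: "'v graph \<Rightarrow> bool" where
  "triangle_free G \<longleftrightarrow>
     \<not> (\<exists>x y z. distinct [x, y, z] \<and> {x, y} \<in> edges G \<and> {y, z} \<in> edges G \<and> {x, z} \<in> edges G)"

definition delete_edges :: "'v graph \<Rightarrow> 'v set set \<Rightarrow> 'v graph" where
  "delete_edges G F = G\<lparr>edges := edges G - F\<rparr>"

definition far_from_triangle_free :: "real \<Rightarrow> 'v graph \<Rightarrow> bool" where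
  "far_from_triangle_free \<epsilon> G \<longleftrightarrow>
     (\<forall>F. F \<subseteq> edges G \<and> triangle_free (delete_edges G F) \<longrightarrow>
        real (card F) \<ge> \<epsilon> * real (card (verts G)) ^ 2)"

definition embeddings :: "'u graph \<Rightarrow> 'v graph \<Rightarrow> ('u \<Rightarrow> 'v) set" where
  "embeddings H G =
     {f \<in> verts H \<rightarrow>\<^sub>E verts G. inj_on f (verts H) \<and> (\<forall>e\<in>edges H. f ` e \<in> edges G)}"

definition Emb :: "'u graph \<Rightarrow> 'v graph \<Rightarrow> nat" where
  "Emb H G = card (embeddings H G)"

text \<open>Every finite graph is isomorphic to one whose vertices are natural numbers, so ranging over
  \<open>nat graph\<close> covers all host graphs.\<close>

definition K3_abundant :: "'u graph set \<Rightarrow> bool" where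
  "K3_abundant \<A> \<longleftrightarrow>
     (\<exists>c C :: real. c > 0 \<and> C > 0 \<and>
       (\<forall>\<epsilon>. 0 < \<epsilon> \<and> \<epsilon> \<le> 1 \<longrightarrow>
         (\<exists>n0 :: nat. \<forall>G :: nat graph.
            finite_simple_graph G \<and> card (verts G) \<ge> n0 \<and> far_from_triangle_free \<epsilon> G \<longrightarrow>
            (\<exists>H\<in>\<A>. real (Emb H G) \<ge> c * \<epsilon> powr C * real (card (verts G)) ^ card (verts H)))))"


section \<open>Turing machines\<close>

text \<open>Deterministic machines with one two-way infinite work tape and a write-only output tape. States
  and tape symbols are natural numbers: \<open>0\<close> is the start state, \<open>1\<close> the accepting state, and \<open>0\<close> the
  blank symbol. The transition function is a finite table; a machine halts when no entry applies.
  Every step may append to the output tape a bit or an end marker that completes an output word.\<close>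

datatype move = Left | Stay | Right

datatype emission = Silent | Bit bool | End_Word

type_synonym tm = "((nat \<times> nat) \<times> (nat \<times> nat \<times> move \<times> emission)) list"

definition turing_machine :: "tm \<Rightarrow> bool" where
  "turing_machine M \<longleftrightarrow> distinct (map fst M)"

text \<open>The output tape is kept split at its end markers: \<open>printed\<close> collects the completed words, and
  \<open>partial\<close> is the unfinished word after the last marker.\<close>

record config =
  state :: nat
  pos :: int
  tape :: "int \<Rightarrow> nat"
  partial :: "bool list"
  printed :: "bool list set"

fun shift :: "move \<Rightarrow> int \<Rightarrow> int" where
  "shift Left i = i - 1"
| "shift Stay i = i"
| "shift Right i = i + 1"

fun emit :: "emission \<Rightarrow> config \<Rightarrow> config" where
  "emit Silent c = c"
| "emit (Bit b) c = c\<lparr>partial := partial c @ [b]\<rparr>"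
| "emit End_Word c = c\<lparr>partial := [], printed := insert (partial c) (printed c)\<rparr>"

definition applicable :: "tm \<Rightarrow> config \<Rightarrow> (nat \<times> nat \<times> move \<times> emission) option" where
  "applicable M c = map_of M (state c, tape c (pos c))"

definition step :: "tm \<Rightarrow> config \<Rightarrow> config" where
  "step M c = (case applicable M c of
       None \<Rightarrow> c
     | Some (q, a, d, e) \<Rightarrow>
         emit e (c\<lparr>state := q, tape := (tape c)(pos c := a), pos := shift d (pos c)\<rparr>))"

text \<open>Input words are binary and occupy the cells from \<open>0\<close> on, with symbol \<open>1\<close> for \<^term>\<open>False\<close> and
  \<open>2\<close> for \<^term>\<open>True\<close>.\<close>

definition input_tape :: "bool list \<Rightarrow> int \<Rightarrow> nat" where
  "input_tape w i =
     (if 0 \<le> i \<and> i < int (length w) then (if w ! nat i then 2 else 1) else 0)"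

definition initial :: "bool list \<Rightarrow> config" where
  "initial w = \<lparr>state = 0, pos = 0, tape = input_tape w, partial = [], printed = {}\<rparr>"

definition run :: "tm \<Rightarrow> bool list \<Rightarrow> nat \<Rightarrow> config" where
  "run M w t = (step M ^^ t) (initial w)"

definition halts :: "tm \<Rightarrow> bool list \<Rightarrow> bool" where
  "halts M w \<longleftrightarrow> (\<exists>t. applicable M (run M w t) = None)"

definition accepts :: "tm \<Rightarrow> bool list \<Rightarrow> bool" where
  "accepts M w \<longleftrightarrow> (\<exists>t. applicable M (run M w t) = None \<and> state (run M w t) = 1)"

definition outputs :: "tm \<Rightarrow> bool list set" where
  "outputs M = (\<Union>t. printed (run M [] t))"


section \<open>Enumeration of graph families\<close>

text \<open>A word describes a graph if it is the row-by-row adjacency matrix with respect to some ordering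
  of the vertices. It thus describes the graph and all its isomorphic copies.\<close>

definition adjacency_word :: "'v graph \<Rightarrow> 'v list \<Rightarrow> bool list" where
  "adjacency_word G vs = concat (map (\<lambda>u. map (\<lambda>v. {u, v} \<in> edges G) vs) vs)"

definition describes :: "bool list \<Rightarrow> 'v graph \<Rightarrow> bool" where
  "describes w G \<longleftrightarrow> (\<exists>vs. distinct vs \<and> set vs = verts G \<and> w = adjacency_word G vs)"

definition enumerates :: "tm \<Rightarrow> 'v graph set \<Rightarrow> bool" where
  "enumerates M \<A> \<longleftrightarrow>
     (\<forall>H\<in>\<A>. \<exists>w\<in>outputs M. describes w H) \<and> (\<forall>w\<in>outputs M. \<exists>H\<in>\<A>. describes w H)"


section \<open>Turing machines as inputs\<close>

text \<open>The standard description of a machine lists its table entries, every component being a number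
  in unary terminated by a \<^term>\<open>False\<close>.\<close>

definition unary :: "nat \<Rightarrow> bool list" where
  "unary n = replicate n True @ [False]"

fun move_number :: "move \<Rightarrow> nat" where
  "move_number Left = 0"
| "move_number Stay = 1"
| "move_number Right = 2"

fun emission_number :: "emission \<Rightarrow> nat" where
  "emission_number Silent = 0"
| "emission_number (Bit False) = 1"
| "emission_number (Bit True) = 2"
| "emission_number End_Word = 3"

fun entry_code :: "(nat \<times> nat) \<times> (nat \<times> nat \<times> move \<times> emission) \<Rightarrow> bool list" where
  "entry_code ((q, a), (q', a', d, e)) =
     unary q @ unary a @ unary q' @ unary a' @ unary (move_number d) @ unary (emission_number e)"

definition tm_code :: "tm \<Rightarrow> bool list" where
  "tm_code M = concat (map entry_code M)"

lemma unary_append_eq_iff: "unary m @ xs = unary n @ ys \<longleftrightarrow> m = n \<and> xs = ys"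
proof (induction m arbitrary: n)
  case 0
  then show ?case by (cases n) (auto simp: unary_def)
next
  case (Suc m)
  then show ?case by (cases n) (auto simp: unary_def)
qed

lemma move_number_eq_iff: "move_number d = move_number d' \<longleftrightarrow> d = d'"
  by (cases d; cases d') auto

lemma emission_number_eq_iff: "emission_number e = emission_number e' \<longleftrightarrow> e = e'"
  by (cases e rule: emission_number.cases; cases e' rule: emission_number.cases) auto

lemma entry_code_append_eq_iff: "entry_code x @ xs = entry_code y @ ys \<longleftrightarrow> x = y \<and> xs = ys"
  by (cases x rule: entry_code.cases; cases y rule: entry_code.cases)
     (simp add: unary_append_eq_iff move_number_eq_iff emission_number_eq_iff)

lemma entry_code_not_Nil: "entry_code x \<noteq> []"
  by (cases x rule: entry_code.cases) (simp add: unary_def)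

lemma inj_tm_code: "inj tm_code"
proof (rule injI)
  fix M N :: tm
  assume "tm_code M = tm_code N"
  then show "M = N"
  proof (induction M arbitrary: N)
    case Nil
    then show ?case by (cases N) (auto simp: tm_code_def entry_code_not_Nil)
  next
    case (Cons x M)
    then show ?case
      by (cases N) (auto simp: tm_code_def entry_code_not_Nil entry_code_append_eq_iff)
  qed
qed

text \<open>The requirement concerns only machines that enumerate a family of finite simple graphs; on other
  inputs the algorithm may behave arbitrarily. Halting in a state other than \<open>1\<close> means the answer no.\<close>

definition decides_K3_abundance :: "tm \<Rightarrow> bool" where
  "decides_K3_abundance D \<longleftrightarrow>
     (\<forall>M. \<forall>\<A> :: nat graph set.
        turing_machine M \<and> (\<forall>H\<in>\<A>. finite_simple_graph H) \<and> enumerates M \<A> \<longrightarrow>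
        halts D (tm_code M) \<and> (accepts D (tm_code M) \<longleftrightarrow> K3_abundant \<A>))"

end

theory Submission
  imports Defs
begin

text \<open>Two very small families already defeat every algorithm. The family that contains only the graph
  without vertices is abundant, since that graph has exactly one embedding into any host. The empty
  family is not abundant, since complete graphs are far from triangle-free and arbitrarily large
  (\<open>complete_graph_far\<close>). A machine that prints nothing enumerates the empty family; one that
  prints exactly the empty word enumerates the other. Deciding abundance therefore includes deciding
  whether a machine ever completes the empty word, and this is undecidable by diagonalization.

  Against a machine \<open>D\<close>, take a machine that obtains its own standard description, runs \<open>D\<close> on it with
  all output suppressed, and prints the empty word exactly if \<open>D\<close> halts with the answer no. It prints
  either nothing or the empty word (\<open>outputs_diagonal_subset\<close>), so it enumerates one of the two
  families and a decider \<open>D\<close> has to halt on it; but every answer of \<open>D\<close> is refuted by what the machine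
  then prints (\<open>outputs_diagonal\<close>).

  What has to be constructed is the self-description. The machine is \<open>core D @ writer 0 w\<close> with
  \<open>w = tm_code (core D)\<close>. The writer has one state per bit of \<open>w\<close> and one more that starts the core;
  it puts \<open>w\<close> on the tape. As the
  description of a concatenation of tables is the concatenation of their descriptions, the core,
  started on \<open>w\<close>, only has to append the description of the writer of \<open>w\<close> (\<open>quoting_program\<close>). The
  core must not depend on the length of \<open>w\<close>, which in turn depends on the core, so their states are
  kept apart by parity: the writer uses the even states, beginning with the initial state \<open>0\<close>, and the
  core the odd ones.

  The core's text processing is given as a program of sweeps. Each sweep starts on the leftmost
  cell, moves right over cells that it skips, rewrites the first other cell, and returns to the
  left end. Such a program acts on the list of tape symbols, so its correctness becomes a
  calculation with lists.\<close>

section \<open>Reachable configurations\<close>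

definition reaches :: "tm \<Rightarrow> config \<Rightarrow> config \<Rightarrow> bool" where
  "reaches M c d \<longleftrightarrow> (\<exists>t. (step M ^^ t) c = d)"

lemma reaches_refl [simp]: "reaches M c c"
  unfolding reaches_def by (rule exI [of _ 0]) simp

lemma reaches_trans [trans]: "reaches M c d \<Longrightarrow> reaches M d e \<Longrightarrow> reaches M c e"
  unfolding reaches_def by (metis comp_apply funpow_add)

lemma reaches_step: "reaches M (step M c) d \<Longrightarrow> reaches M c d"
  unfolding reaches_def by (metis comp_apply funpow_Suc_right)

lemma emit_keeps:
  "state (emit e c) = state c" "pos (emit e c) = pos c" "tape (emit e c) = tape c"
  "printed c \<subseteq> printed (emit e c)"
  by (cases e; auto)+

lemma printed_step: "printed c \<subseteq> printed (step M c)"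
  using emit_keeps(4) by (fastforce simp: step_def split: option.split)

lemma printed_mono:
  assumes "s \<le> t"
  shows "printed ((step M ^^ s) c) \<subseteq> printed ((step M ^^ t) c)"
  using assms by (induction rule: dec_induct) (use printed_step in \<open>auto\<close>)

lemma halted_stays: "applicable M c = None \<Longrightarrow> (step M ^^ t) c = c"
  by (induction t) (simp_all add: step_def)

lemma halted_run_unique:
  assumes "applicable M (run M w s) = None" "applicable M (run M w t) = None"
  shows "run M w s = run M w t"
proof -
  have "run M w t = run M w s" if "applicable M (run M w s) = None" "s \<le> t" for s t
    using halted_stays [OF that(1), of "t - s"] that(2)
    unfolding run_def by (metis comp_apply funpow_add le_add_diff_inverse2)
  then show ?thesis
    using assms by (metis nat_le_linear)
qed

text \<open>Printed words are never retracted and nothing happens after halting, so the last configuration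
  carries the whole output.\<close>
lemma outputs_of_halting_run:
  assumes "reaches M (initial []) c" "applicable M c = None"
  shows "outputs M = printed c"
proof -
  obtain t where t: "(step M ^^ t) (initial []) = c"
    using assms(1) by (auto simp: reaches_def)
  have "printed ((step M ^^ s) (initial [])) \<subseteq> printed c" for s
  proof (cases "s \<le> t")
    case True
    then show ?thesis using printed_mono t by blast
  next
    case False
    then have "(step M ^^ s) (initial []) = (step M ^^ (s - t)) c"
      using t by (metis comp_apply funpow_add le_add_diff_inverse2 nat_le_linear)
    then show ?thesis using halted_stays [OF assms(2)] by simp
  qed
  then show ?thesis
    unfolding outputs_def run_def using t by blast
qed

section \<open>The tape as a list\<close>

definition tape_of :: "nat list \<Rightarrow> int \<Rightarrow> nat" where
  "tape_of xs i = (if 0 \<le> i \<and> i < int (length xs) then xs ! nat i else 0)"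

text \<open>Tape symbols carry a bit and one of four marks: \<open>0\<close> for an input bit not yet processed, \<open>1\<close> for a
  processed one, \<open>2\<close> for a processed one already counted in the current counting pass, and \<open>3\<close> for
  generated text. Mark \<open>0\<close> yields the input alphabet of the machine model.\<close>
definition cell :: "nat \<Rightarrow> bool \<Rightarrow> nat" where
  "cell k b = 2 * k + (if b then 2 else 1)"

lemma input_tape_eq_tape_of: "input_tape w = tape_of (map (cell 0) w)"
  by (auto simp: input_tape_def tape_of_def cell_def fun_eq_iff)

lemma tape_of_outside: "i < 0 \<or> int (length xs) \<le> i \<Longrightarrow> tape_of xs i = 0"
  by (auto simp: tape_of_def)

lemma tape_of_append_left: "j < length ys \<Longrightarrow> tape_of (ys @ zs) (int j) = ys ! j"
  by (auto simp: tape_of_def nth_append)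

lemma tape_of_hit: "tape_of (ys @ a # zs) (int (length ys)) = a"
  by (auto simp: tape_of_def)

lemma tape_of_write: "(tape_of (ys @ a # zs))(int (length ys) := b) = tape_of (ys @ b # zs)"
proof -
  have "(tape_of xs)(int i := b) = tape_of (xs[i := b])" if "i < length xs" for xs i
    using that by (auto simp: tape_of_def fun_eq_iff nth_list_update)
  from this [of "length ys" "ys @ a # zs"] show ?thesis by simp
qed

lemma tape_of_extend: "(tape_of xs)(int (length xs) := b) = tape_of (xs @ [b])"
  by (auto simp: tape_of_def fun_eq_iff nth_append)

lemma tape_of_blank: "(tape_of xs)(int (length xs) := 0) = tape_of xs"
  by (auto simp: tape_of_def fun_eq_iff)

text \<open>Until the decider has answered nothing may be printed; runs up to that point stay within the
  following configurations.\<close>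
abbreviation silent :: "nat \<Rightarrow> int \<Rightarrow> (int \<Rightarrow> nat) \<Rightarrow> config" where
  "silent q p tp \<equiv> \<lparr>state = q, pos = p, tape = tp, partial = [], printed = {}\<rparr>"

lemma silent_step:
  assumes "map_of M (q, tp p) = Some (q', a, d, Silent)"
    and "reaches M (silent q' (shift d p) (tp(p := a))) c"
  shows "reaches M (silent q p tp) c"
  by (rule reaches_step) (use assms in \<open>simp add: step_def applicable_def\<close>)

text \<open>A machine that stays in one state and leaves the cells unchanged walks along them; \<open>k\<close> is \<open>1\<close> or
  \<open>- 1\<close> according to the direction, so that both halves of a sweep are covered.\<close>
lemma scan:
  assumes "\<And>j. j < n \<Longrightarrow>
      map_of M (q, tp (p + k * int j)) = Some (q, tp (p + k * int j), d, Silent)"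
    and "\<And>i. shift d i = i + k"
  shows "reaches M (silent q p tp) (silent q (p + k * int n) tp)"
  using assms(1)
proof (induction n)
  case 0
  then show ?case by simp
next
  case (Suc n)
  have "reaches M (silent q (p + k * int n) tp) (silent q (p + k * int (Suc n)) tp)"
    by (rule silent_step [where q' = q and a = "tp (p + k * int n)" and d = d])
       (use Suc.prems [of n] in \<open>simp_all add: assms(2) algebra_simps\<close>)
  then show ?case
    using Suc by (meson less_SucI reaches_trans)
qed

section \<open>Sweep programs\<close>

text \<open>A sweep maps a symbol to \<open>None\<close> if it is skipped, and otherwise to the next program line and the
  symbol that replaces it. The blank behind the text is never skipped.\<close>
type_synonym sweep = "nat \<Rightarrow> (nat \<times> nat) option"

text \<open>\<open>count\<close> and \<open>uncount\<close> are the bodies of two loops: the first marks the next processed cell as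
  counted, the second removes such a mark. Each leaves for its second argument when no cell is
  left.\<close>
definition count :: "nat \<Rightarrow> nat \<Rightarrow> sweep" where
  "count q q' a = (if a \<in> {5, 6} then None else if a \<in> {3, 4} then Some (q, a + 2) else Some (q', a))"

definition uncount :: "nat \<Rightarrow> nat \<Rightarrow> sweep" where
  "uncount q q' a = (if a \<in> {3, 4} then None else if a \<in> {5, 6} then Some (q, a - 2) else Some (q', a))"

definition append_bit :: "bool \<Rightarrow> nat \<Rightarrow> sweep" where
  "append_bit b q a = (if a = 0 then Some (q, cell 3 b) else None)"

definition test_done :: "nat \<Rightarrow> nat \<Rightarrow> sweep" where
  "test_done q q' a = (if a \<in> {3, 4} then None else if a \<in> {1, 2} then Some (q, a) else Some (q', a))"

text \<open>The two exits let the program branch on the bit that has just been processed.\<close>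
definition mark_next :: "nat \<Rightarrow> nat \<Rightarrow> sweep" where
  "mark_next q q' a = (if a \<in> {3, 4} then None else if a = 1 then Some (q, 3) else Some (q', 4))"

definition erase_marks :: "nat \<Rightarrow> nat \<Rightarrow> sweep" where
  "erase_marks q q' a =
     (if a = 0 then Some (q', 0) else if a \<in> {1, 2} then None
      else Some (q, if odd a then 1 else 2))"

text \<open>The program that appends the description of the writer. The writer's entry for bit number \<open>i\<close> has
  key state \<open>2 * i\<close> and next state \<open>2 * i + 2\<close>. When it is described, exactly \<open>i\<close> bits are marked as
  processed, and a counting pass that appends two \<^term>\<open>True\<close> per processed bit yields these numbers
  in unary.

  Lines \<open>0\<close> to \<open>5\<close> produce the key; line \<open>6\<close> goes to \<open>22\<close> if all bits have been processed. Lines \<open>7\<close> to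
  \<open>13\<close> produce the next state. Line \<open>14\<close> processes the bit and selects between the two codes of the
  symbol to be written, which differ by the \<^term>\<open>True\<close> of line \<open>15\<close>; the lines up to \<open>21\<close> complete
  the entry. Lines \<open>22\<close> to \<open>26\<close> complete the writer's last entry, and line \<open>27\<close> removes all marks.\<close>
definition quoter :: "sweep list" where
  "quoter =
    [count 1 3, append_bit True 2, append_bit True 0, uncount 3 4,
     append_bit False 5, append_bit False 6,
     test_done 7 22,
     count 8 10, append_bit True 9, append_bit True 7, uncount 10 11,
     append_bit True 12, append_bit True 13, append_bit False 14,
     mark_next 16 15,
     append_bit True 16, append_bit True 17, append_bit False 18,
     append_bit True 19, append_bit True 20, append_bit False 21, append_bit False 0,
     append_bit True 23, append_bit False 24, append_bit False 25, append_bit False 26,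
     append_bit False 27,
     erase_marks 27 28]"

section \<open>The diagonal machine\<close>

text \<open>The number \<open>2\<close> is included because the input consists of symbols up to \<open>2\<close>: every state and every
  symbol that a run of \<open>D\<close> meets is at most \<open>bound D\<close>.\<close>
definition bound :: "tm \<Rightarrow> nat" where
  "bound D = Max ({2} \<union> (\<Union>((q, a), (q', a', d, e)) \<in> set D. {q, q', a'}))"

text \<open>Line \<open>q\<close> of the program uses the state \<open>4 * q + 3\<close> while it scans to the right, and is entered
  through the state \<open>4 * q + 1\<close>, which returns to the left end. The program has lines \<open>0\<close> to \<open>27\<close>;
  line \<open>28\<close> stands for the start of the decider, so it has a return state but no sweep. There are
  nine tape symbols, the blank and four marked versions of each bit.\<close>
definition return_entries :: tm where
  "return_entries =
     map (\<lambda>(q, a). ((4 * q + 1, a),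
            if a = 0 then (4 * q + 3, 0, Right, Silent) else (4 * q + 1, a, Left, Silent)))
         (List.product [0..<29] [0..<9])"

definition sweep_entries :: tm where
  "sweep_entries =
     map (\<lambda>(q, a). ((4 * q + 3, a),
            case (quoter ! q) a of
              None \<Rightarrow> (4 * q + 3, a, Right, Silent)
            | Some (q', a') \<Rightarrow> (4 * q' + 1, a', Left, Silent)))
         (List.product [0..<28] [0..<9])"

text \<open>The decider's initial state is \<open>4 * 28 + 3\<close>, the state in which line \<open>28\<close> of the program would
  scan. All its states are odd.\<close>
definition decider_state :: "nat \<Rightarrow> nat" where
  "decider_state s = 115 + 2 * s"

definition decider_entries :: "tm \<Rightarrow> tm" where
  "decider_entries D =
     map (\<lambda>((q, a), (q', a', d, e)). ((decider_state q, a), (decider_state q', a', d, Silent))) D"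

text \<open>Where \<open>D\<close> halts in a state other than the accepting one, the diagonal machine completes the empty
  word and moves to a state that has no entries.\<close>
definition rejection_entries :: "tm \<Rightarrow> tm" where
  "rejection_entries D =
     map (\<lambda>(q, a). ((decider_state q, a), (decider_state (Suc (bound D)), a, Stay, End_Word)))
       (filter (\<lambda>(q, a). q \<noteq> 1 \<and> map_of D (q, a) = None)
         (List.product [0..<Suc (bound D)] [0..<Suc (bound D)]))"

definition core :: "tm \<Rightarrow> tm" where
  "core D = return_entries @ sweep_entries @ decider_entries D @ rejection_entries D"

text \<open>The last entry leads to state \<open>1\<close>, the return state of line \<open>0\<close>, and so starts the program.\<close>
primrec writer :: "nat \<Rightarrow> bool list \<Rightarrow> tm" where
  "writer i [] = [((2 * i, 0), (1, 0, Left, Silent))]"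
| "writer i (b # w) = ((2 * i, 0), (2 * Suc i, cell 0 b, Right, Silent)) # writer (Suc i) w"

definition diagonal :: "tm \<Rightarrow> tm" where
  "diagonal D = core D @ writer 0 (tm_code (core D))"

lemma distinct_return: "distinct (map fst return_entries)"
  unfolding return_entries_def
  by (auto simp: distinct_map distinct_product inj_on_def)

lemma distinct_sweep: "distinct (map fst sweep_entries)"
  unfolding sweep_entries_def
  by (auto simp: distinct_map distinct_product inj_on_def)

lemma keys_decider:
  "map fst (decider_entries D) = map (\<lambda>(q, a). (decider_state q, a)) (map fst D)"
  unfolding decider_entries_def by (simp add: case_prod_unfold)

lemma inj_decider_key: "inj_on (\<lambda>(q, a). (decider_state q, a)) A"
  by (auto simp: inj_on_def decider_state_def)

lemma distinct_decider: "turing_machine D \<Longrightarrow> distinct (map fst (decider_entries D))"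
  unfolding keys_decider turing_machine_def
  by (simp only: distinct_map [of _ "map fst D"] inj_decider_key)

lemma keys_rejection:
  "map fst (rejection_entries D) = map (\<lambda>(q, a). (decider_state q, a))
     (filter (\<lambda>(q, a). q \<noteq> 1 \<and> map_of D (q, a) = None)
       (List.product [0..<Suc (bound D)] [0..<Suc (bound D)]))"
  unfolding rejection_entries_def map_map by (rule map_cong) auto

lemma distinct_rejection: "distinct (map fst (rejection_entries D))"
  unfolding keys_rejection
  by (simp only: distinct_map inj_decider_key distinct_filter distinct_product distinct_upt)

lemma key_ranges:
  "k \<in> set (map fst return_entries) \<Longrightarrow> fst k mod 4 = 1 \<and> fst k < 115"
  "k \<in> set (map fst sweep_entries) \<Longrightarrow> fst k mod 4 = 3 \<and> fst k < 115"
  "k \<in> set (map fst (decider_entries D)) \<Longrightarrow> odd (fst k) \<and> 115 \<le> fst k"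
  "k \<in> set (map fst (rejection_entries D)) \<Longrightarrow> odd (fst k) \<and> 115 \<le> fst k"
proof -
  show "k \<in> set (map fst return_entries) \<Longrightarrow> fst k mod 4 = 1 \<and> fst k < 115"
    by (auto simp: return_entries_def)
  show "k \<in> set (map fst sweep_entries) \<Longrightarrow> fst k mod 4 = 3 \<and> fst k < 115"
    by (auto simp: sweep_entries_def)
  show "k \<in> set (map fst (decider_entries D)) \<Longrightarrow> odd (fst k) \<and> 115 \<le> fst k"
    unfolding keys_decider by (auto simp: decider_state_def)
  show "k \<in> set (map fst (rejection_entries D)) \<Longrightarrow> odd (fst k) \<and> 115 \<le> fst k"
    unfolding keys_rejection by (auto simp: decider_state_def)
qed

lemma odd_keys_core:
  assumes "k \<in> set (map fst (core D))"
  shows "odd (fst k)"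
proof -
  have "odd (n::nat)" if "n mod 4 = 1 \<or> n mod 4 = 3" for n
    using that by presburger
  moreover have "k \<in> set (map fst return_entries) \<or> k \<in> set (map fst sweep_entries)
      \<or> k \<in> set (map fst (decider_entries D)) \<or> k \<in> set (map fst (rejection_entries D))"
    using assms by (simp only: core_def map_append set_append Un_iff)
  ultimately show ?thesis
    using key_ranges by blast
qed

lemma distinct_core:
  assumes "turing_machine D"
  shows "distinct (map fst (core D))"
proof -
  have "set (map fst (decider_entries D)) \<inter> set (map fst (rejection_entries D)) = {}"
    unfolding keys_decider keys_rejection by (auto simp: decider_state_def map_of_eq_None_iff) (force intro: rev_image_eqI)+
  moreover have "set (map fst return_entries) \<inter> set (map fst sweep_entries) = {}"
    using key_ranges(1,2) by (metis disjoint_iff num.distinct(3) numeral_eq_one_iff)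
  moreover have "set (map fst return_entries) \<inter> set (map fst (decider_entries D)) = {}"
    "set (map fst return_entries) \<inter> set (map fst (rejection_entries D)) = {}"
    "set (map fst sweep_entries) \<inter> set (map fst (decider_entries D)) = {}"
    "set (map fst sweep_entries) \<inter> set (map fst (rejection_entries D)) = {}"
    using key_ranges by (meson disjoint_iff not_le)+
  ultimately show ?thesis
    using distinct_return distinct_sweep distinct_decider [OF assms] distinct_rejection [of D]
    by (simp only: core_def map_append distinct_append set_append Int_Un_distrib) simp
qed

lemma keys_writer: "map fst (writer i w) = map (\<lambda>j. (2 * j, 0)) [i..<Suc (i + length w)]"
  by (induction w arbitrary: i) (simp_all add: upt_rec)

lemma even_keys_writer: "k \<in> set (map fst (writer i w)) \<Longrightarrow> even (fst k)"
  by (simp only: keys_writer) auto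

lemma turing_machine_diagonal:
  assumes "turing_machine D"
  shows "turing_machine (diagonal D)"
proof -
  have "distinct (map fst (writer 0 w))" for w
    by (simp only: keys_writer) (auto simp: distinct_map inj_on_def)
  then show ?thesis
    using distinct_core [OF assms] odd_keys_core even_keys_writer
    unfolding turing_machine_def diagonal_def map_append distinct_append by (metis disjoint_iff)
qed


lemma core_lookup:
  assumes "turing_machine D" "(k, v) \<in> set (core D)"
  shows "map_of (diagonal D) k = Some v"
  using turing_machine_diagonal [OF assms(1)] assms(2)
  by (auto simp: turing_machine_def diagonal_def intro!: map_of_is_SomeI)

lemma return_lookup:
  assumes "turing_machine D" "q < 29" "a < 9"
  shows "map_of (diagonal D) (4 * q + 1, a) =
    Some (if a = 0 then (4 * q + 3, 0, Right, Silent) else (4 * q + 1, a, Left, Silent))"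
  by (rule core_lookup [OF assms(1)])
     (use assms(2,3) in \<open>force simp: core_def return_entries_def\<close>)

lemma sweep_lookup:
  assumes "turing_machine D" "q < 28" "a < 9"
  shows "map_of (diagonal D) (4 * q + 3, a) =
    Some (case (quoter ! q) a of
            None \<Rightarrow> (4 * q + 3, a, Right, Silent)
          | Some (q', a') \<Rightarrow> (4 * q' + 1, a', Left, Silent))"
  by (rule core_lookup [OF assms(1)])
     (use assms(2,3) in \<open>force simp: core_def sweep_entries_def\<close>)

section \<open>Running a sweep program\<close>

definition conf :: "nat \<Rightarrow> nat list \<Rightarrow> config" where
  "conf q xs = silent (4 * q + 3) 0 (tape_of xs)"

locale diagonalization =
  fixes D :: tm
  assumes machine: "turing_machine D"
begin

abbreviation reach :: "config \<Rightarrow> config \<Rightarrow> bool" (infix "\<leadsto>" 50) where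
  "c \<leadsto> d \<equiv> reaches (diagonal D) c d"

text \<open>The program never blanks a cell of the text, so the first blank met on the way back is the one
  in front of it.\<close>
lemma return_to_start:
  assumes "q < 29" "set xs \<subseteq> {1..8}" "n \<le> length xs"
  shows "silent (4 * q + 1) (int n - 1) (tape_of xs) \<leadsto> conf q xs"
proof -
  have "map_of (diagonal D) (4 * q + 1, tape_of xs (int n - 1 + - 1 * int j)) =
      Some (4 * q + 1, tape_of xs (int n - 1 + - 1 * int j), Left, Silent)" if "j < n" for j
  proof -
    have "int n - 1 + - 1 * int j = int (n - 1 - j)" "n - 1 - j < length xs"
      using that assms(3) by auto
    then have "tape_of xs (int n - 1 + - 1 * int j) = xs ! (n - 1 - j)" "xs ! (n - 1 - j) \<in> set xs"
      using tape_of_append_left [of "n - 1 - j" xs "[]"] by simp_all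
    moreover have "xs ! (n - 1 - j) \<in> {1..8}"
      using assms(2) calculation(2) by blast
    ultimately show ?thesis
      using return_lookup [OF machine assms(1), of "xs ! (n - 1 - j)"] by simp
  qed
  then have "silent (4 * q + 1) (int n - 1) (tape_of xs) \<leadsto>
      silent (4 * q + 1) (int n - 1 + - 1 * int n) (tape_of xs)"
    by (rule scan) simp_all
  also have "silent (4 * q + 1) (int n - 1 + - 1 * int n) (tape_of xs) \<leadsto> conf q xs"
  proof (rule silent_step)
    show "map_of (diagonal D) (4 * q + 1, tape_of xs (int n - 1 + - 1 * int n)) =
        Some (4 * q + 3, 0, Right, Silent)"
      using return_lookup [OF machine assms(1), of 0] by (simp add: tape_of_outside)
    have "(tape_of xs)(- 1 := 0) = tape_of xs"
      by (auto simp: tape_of_def)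
    then show "silent (4 * q + 3) (shift Right (int n - 1 + - 1 * int n))
        ((tape_of xs)(int n - 1 + - 1 * int n := 0)) \<leadsto> conf q xs"
      by (simp add: conf_def)
  qed
  finally show ?thesis .
qed

text \<open>This is the interface between machine runs and lists: \<open>ys\<close> is the skipped part, and the hit cell is
  the first of \<open>zs\<close>, or the blank behind the text if \<open>zs\<close> is empty. The three special cases below are
  the ones that occur in the program.\<close>
lemma sweep:
  assumes "q < 28" "q' < 29"
    and skipped: "\<And>y. y \<in> set ys \<Longrightarrow> (quoter ! q) y = None"
    and hit: "(quoter ! q) (tape_of zs 0) = Some (q', a')"
    and old: "set (ys @ zs) \<subseteq> {1..8}"
    and new: "set (ys @ zs') \<subseteq> {1..8}"
    and written: "(tape_of (ys @ zs))(int (length ys) := a') = tape_of (ys @ zs')"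
  shows "conf q (ys @ zs) \<leadsto> conf q' (ys @ zs')"
proof -
  let ?tp = "tape_of (ys @ zs)"
  have "map_of (diagonal D) (4 * q + 3, ?tp (0 + 1 * int j)) =
      Some (4 * q + 3, ?tp (0 + 1 * int j), Right, Silent)" if "j < length ys" for j
  proof -
    have "ys ! j \<in> set ys" using that by simp
    then have "ys ! j < 9" using old by fastforce
    then show ?thesis
      using sweep_lookup [OF machine assms(1), of "ys ! j"] skipped \<open>ys ! j \<in> set ys\<close> that
      by (simp add: tape_of_append_left)
  qed
  then have "conf q (ys @ zs) \<leadsto> silent (4 * q + 3) (0 + 1 * int (length ys)) ?tp"
    unfolding conf_def by (rule scan) simp_all
  also have "silent (4 * q + 3) (0 + 1 * int (length ys)) ?tp \<leadsto> conf q' (ys @ zs')"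
  proof (rule silent_step)
    have head: "?tp (int (length ys)) = tape_of zs 0"
      by (auto simp: tape_of_def nth_append)
    have "tape_of zs 0 < 9"
      using old by (cases zs) (auto simp: tape_of_def)
    then show "map_of (diagonal D) (4 * q + 3, ?tp (0 + 1 * int (length ys))) =
        Some (4 * q' + 1, a', Left, Silent)"
      using sweep_lookup [OF machine assms(1), of "tape_of zs 0"] hit head by simp
    show "silent (4 * q' + 1) (shift Left (0 + 1 * int (length ys)))
        (?tp(0 + 1 * int (length ys) := a')) \<leadsto> conf q' (ys @ zs')"
      using return_to_start [OF assms(2) new, of "length ys"] written by simp
  qed
  finally show ?thesis .
qed

lemma sweep_rewrite:
  assumes "q < 28" "q' < 29"
    and "\<And>y. y \<in> set ys \<Longrightarrow> (quoter ! q) y = None"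
    and "(quoter ! q) a = Some (q', a')"
    and "set (ys @ a # zs) \<subseteq> {1..8}" "a' \<in> {1..8}"
  shows "conf q (ys @ a # zs) \<leadsto> conf q' (ys @ a' # zs)"
  by (rule sweep [OF assms(1-3)])
     (use assms(4-6) in \<open>auto simp: tape_of_write tape_of_hit [of "[]", simplified]\<close>)

lemma sweep_keep:
  assumes "q < 28" "q' < 29"
    and "\<And>y. y \<in> set ys \<Longrightarrow> (quoter ! q) y = None"
    and "(quoter ! q) (tape_of zs 0) = Some (q', tape_of zs 0)"
    and "set (ys @ zs) \<subseteq> {1..8}"
  shows "conf q (ys @ zs) \<leadsto> conf q' (ys @ zs)"
proof (rule sweep [OF assms(1-4)])
  have "tape_of zs 0 = tape_of (ys @ zs) (int (length ys))"
    by (auto simp: tape_of_def nth_append)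
  then show "(tape_of (ys @ zs))(int (length ys) := tape_of zs 0) = tape_of (ys @ zs)"
    by simp
qed (use assms(5) in auto)

lemma sweep_end:
  assumes "q < 28" "q' < 29"
    and "\<And>y. y \<in> set xs \<Longrightarrow> (quoter ! q) y = None"
    and "(quoter ! q) 0 = Some (q', a')" "set xs \<subseteq> {1..8}" "a' \<in> {1..8}"
  shows "conf q xs \<leadsto> conf q' (xs @ [a'])"
proof -
  have "conf q (xs @ []) \<leadsto> conf q' (xs @ [a'])"
    by (rule sweep [OF assms(1-3)])
       (use assms(4-6) in \<open>auto simp: tape_of_extend tape_of_outside\<close>)
  then show ?thesis by simp
qed

section \<open>What the quoting program computes\<close>

lemma cell_bounds [simp]: "Suc 0 \<le> cell k b" "k \<le> 3 \<Longrightarrow> cell k b \<le> 8"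
  "k \<le> 3 \<Longrightarrow> cell k ` A \<subseteq> {Suc 0..8}"
  by (auto simp: cell_def)

lemma append_step:
  assumes "quoter ! q = append_bit b q'" "q < 28" "q' < 29" "set xs \<subseteq> {1..8}"
  shows "conf q (xs @ map (cell 3) bs) \<leadsto> conf q' (xs @ map (cell 3) (bs @ [b]))"
proof -
  have "conf q (xs @ map (cell 3) bs) \<leadsto> conf q' ((xs @ map (cell 3) bs) @ [cell 3 b])"
    by (rule sweep_end) (use assms in \<open>auto simp: append_bit_def cell_def\<close>)
  then show ?thesis by simp
qed

text \<open>In a list of pairs, each bit is accompanied by the line that follows its appending.\<close>
primrec writes :: "nat \<Rightarrow> (bool \<times> nat) list \<Rightarrow> bool" where
  "writes q [] \<longleftrightarrow> True"
| "writes q (x # xs) \<longleftrightarrow>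
     quoter ! q = append_bit (fst x) (snd x) \<and> q < 28 \<and> snd x < 29 \<and> writes (snd x) xs"

lemma append_bits:
  assumes "writes q ps" "set xs \<subseteq> {1..8}"
  shows "conf q (xs @ map (cell 3) bs) \<leadsto>
    conf (last (q # map snd ps)) (xs @ map (cell 3) (bs @ map fst ps))"
  using assms(1)
proof (induction ps arbitrary: q bs)
  case Nil
  then show ?case by simp
next
  case (Cons p ps)
  have "conf q (xs @ map (cell 3) bs) \<leadsto> conf (snd p) (xs @ map (cell 3) (bs @ [fst p]))"
    using Cons.prems assms(2) by (intro append_step) auto
  also have "\<dots> \<leadsto> conf (last (snd p # map snd ps)) (xs @ map (cell 3) ((bs @ [fst p]) @ map fst ps))"
    using Cons by (intro Cons.IH) auto
  finally show ?case by simp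
qed

lemma head_unmarked:
  "tape_of (map (cell 0) ys @ map (cell 3) bs) 0 \<in> {0, 1, 2, 7, 8}"
  by (cases ys; cases bs) (auto simp: tape_of_def cell_def)

text \<open>Each processed bit contributes two appended bits. The loop ends on the first cell behind the
  processed bits, whatever comes there, as none of those symbols is marked as processed
  (\<open>head_unmarked\<close>).\<close>
lemma counting:
  assumes prog: "quoter ! s = count s1 s3" "quoter ! s1 = append_bit True s2"
      "quoter ! s2 = append_bit True s" and s: "s < 28" "s1 < 28" "s2 < 28" "s3 < 28"
  shows "conf s (map (cell 2) us @ map (cell 1) vs @ map (cell 0) ys @ map (cell 3) bs) \<leadsto>
    conf s3 (map (cell 2) (us @ vs) @ map (cell 0) ys @
      map (cell 3) (bs @ replicate (2 * length vs) True))"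
proof (induction vs arbitrary: us bs)
  case Nil
  have "conf s (map (cell 2) us @ map (cell 0) ys @ map (cell 3) bs) \<leadsto>
      conf s3 (map (cell 2) us @ map (cell 0) ys @ map (cell 3) bs)"
    by (rule sweep_keep) (use s head_unmarked [of ys bs] in \<open>auto simp: prog count_def cell_def split: if_splits\<close>)
  then show ?case by simp
next
  case (Cons v vs)
  let ?xs = "map (cell 2) (us @ [v]) @ map (cell 1) vs @ map (cell 0) ys"
  have xs: "set ?xs \<subseteq> {1..8}" by auto
  have "conf s (map (cell 2) us @ cell 1 v # map (cell 1) vs @ map (cell 0) ys @ map (cell 3) bs) \<leadsto>
      conf s1 (map (cell 2) us @ cell 2 v # map (cell 1) vs @ map (cell 0) ys @ map (cell 3) bs)"
    by (rule sweep_rewrite) (use s in \<open>auto simp: prog count_def cell_def split: if_splits\<close>)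
  also have "map (cell 2) us @ cell 2 v # map (cell 1) vs @ map (cell 0) ys @ map (cell 3) bs =
      ?xs @ map (cell 3) bs"
    by simp
  also have "conf s1 (?xs @ map (cell 3) bs) \<leadsto> conf s (?xs @ map (cell 3) (bs @ [True, True]))"
    using append_bits [of s1 "[(True, s2), (True, s)]" ?xs bs] s xs prog
    by (simp add: numeral_2_eq_2)
  also have "conf s (?xs @ map (cell 3) (bs @ [True, True])) \<leadsto>
     conf s3 (map (cell 2) ((us @ [v]) @ vs) @ map (cell 0) ys @
      map (cell 3) ((bs @ [True, True]) @ replicate (2 * length vs) True))"
    using Cons.IH [of "us @ [v]" "bs @ [True, True]"] by simp
  finally show ?case by simp
qed

lemma uncounting:
  assumes prog: "quoter ! s = uncount s s'" and s: "s < 28" "s' < 29"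
  shows "conf s (map (cell 1) us @ map (cell 2) vs @ map (cell 0) ys @ map (cell 3) bs) \<leadsto>
    conf s' (map (cell 1) (us @ vs) @ map (cell 0) ys @ map (cell 3) bs)"
proof (induction vs arbitrary: us)
  case Nil
  have "conf s (map (cell 1) us @ map (cell 0) ys @ map (cell 3) bs) \<leadsto>
      conf s' (map (cell 1) us @ map (cell 0) ys @ map (cell 3) bs)"
    by (rule sweep_keep) (use s head_unmarked [of ys bs] in \<open>auto simp: prog uncount_def cell_def split: if_splits\<close>)
  then show ?case by simp
next
  case (Cons v vs)
  have "conf s (map (cell 1) us @ cell 2 v # map (cell 2) vs @ map (cell 0) ys @ map (cell 3) bs) \<leadsto>
      conf s (map (cell 1) us @ cell 1 v # map (cell 2) vs @ map (cell 0) ys @ map (cell 3) bs)"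
    by (rule sweep_rewrite) (use s in \<open>auto simp: prog uncount_def cell_def split: if_splits\<close>)
  also have "\<dots> \<leadsto> conf s' (map (cell 1) ((us @ [v]) @ vs) @ map (cell 0) ys @ map (cell 3) bs)"
    using Cons.IH [of "us @ [v]"] by simp
  finally show ?case by simp
qed

lemma count_pass:
  assumes "quoter ! s = count s1 s3" "quoter ! s1 = append_bit True s2"
      "quoter ! s2 = append_bit True s" "quoter ! s3 = uncount s3 s4"
    and "s < 28" "s1 < 28" "s2 < 28" "s3 < 28" "s4 < 29"
  shows "conf s (map (cell 1) xs @ map (cell 0) ys @ map (cell 3) bs) \<leadsto>
    conf s4 (map (cell 1) xs @ map (cell 0) ys @
      map (cell 3) (bs @ replicate (2 * length xs) True))"
proof -
  let ?bs = "bs @ replicate (2 * length xs) True"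
  have "conf s (map (cell 1) xs @ map (cell 0) ys @ map (cell 3) bs) \<leadsto>
    conf s3 (map (cell 2) xs @ map (cell 0) ys @ map (cell 3) ?bs)"
    using counting [OF assms(1-3,5-8), of "[]" xs ys bs] by simp
  also have "\<dots> \<leadsto> conf s4 (map (cell 1) xs @ map (cell 0) ys @ map (cell 3) ?bs)"
    using uncounting [OF assms(4,8,9), of "[]" xs ys ?bs] by simp
  finally show ?thesis .
qed

lemma quoter_simps:
  "quoter ! 0 = count 1 3" "quoter ! 1 = append_bit True 2" "quoter ! 2 = append_bit True 0"
  "quoter ! 3 = uncount 3 4"
  "quoter ! 4 = append_bit False 5" "quoter ! 5 = append_bit False 6"
  "quoter ! 6 = test_done 7 22"
  "quoter ! 7 = count 8 10" "quoter ! 8 = append_bit True 9" "quoter ! 9 = append_bit True 7"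
  "quoter ! 10 = uncount 10 11"
  "quoter ! 11 = append_bit True 12" "quoter ! 12 = append_bit True 13"
  "quoter ! 13 = append_bit False 14"
  "quoter ! 14 = mark_next 16 15"
  "quoter ! 15 = append_bit True 16" "quoter ! 16 = append_bit True 17"
  "quoter ! 17 = append_bit False 18" "quoter ! 18 = append_bit True 19"
  "quoter ! 19 = append_bit True 20" "quoter ! 20 = append_bit False 21"
  "quoter ! 21 = append_bit False 0"
  "quoter ! 22 = append_bit True 23" "quoter ! 23 = append_bit False 24"
  "quoter ! 24 = append_bit False 25" "quoter ! 25 = append_bit False 26"
  "quoter ! 26 = append_bit False 27" "quoter ! 27 = erase_marks 27 28"
  by (simp_all add: quoter_def)

text \<open>The writer's last entry begins like the others, with a key state of twice the number of
  processed bits and the blank symbol. Therefore one loop serves all entries, and the exit is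
  taken between the key and the rest.\<close>
lemma quoting_entry_start:
  "conf 0 (map (cell 1) xs @ map (cell 0) ys @ map (cell 3) bs) \<leadsto>
   conf (if ys = [] then 22 else 7) (map (cell 1) xs @ map (cell 0) ys @
     map (cell 3) (bs @ unary (2 * length xs) @ unary 0))"
proof -
  let ?bs = "bs @ replicate (2 * length xs) True"
  have "conf 0 (map (cell 1) xs @ map (cell 0) ys @ map (cell 3) bs) \<leadsto>
      conf 4 (map (cell 1) xs @ map (cell 0) ys @ map (cell 3) ?bs)"
    by (rule count_pass [OF quoter_simps(1-4)]) simp_all
  also have "conf 4 (map (cell 1) xs @ map (cell 0) ys @ map (cell 3) ?bs) \<leadsto>
      conf 6 (map (cell 1) xs @ map (cell 0) ys @ map (cell 3) (?bs @ [False, False]))"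
    using append_bits [of 4 "[(False, 5), (False, 6)]" "map (cell 1) xs @ map (cell 0) ys" ?bs]
    by (auto simp: quoter_simps)
  also have "\<dots> \<leadsto> conf (if ys = [] then 22 else 7)
      (map (cell 1) xs @ map (cell 0) ys @ map (cell 3) (?bs @ [False, False]))"
  proof (rule sweep_keep)
    have "tape_of (map (cell 0) ys @ map (cell 3) (?bs @ [False, False])) 0
        \<in> (if ys = [] then {7, 8} else {1, 2})"
      by (cases ys; cases "?bs @ [False, False]") (auto simp: tape_of_def cell_def)
    then show "(quoter ! 6) (tape_of (map (cell 0) ys @ map (cell 3) (?bs @ [False, False])) 0) =
        Some (if ys = [] then 22 else 7,
          tape_of (map (cell 0) ys @ map (cell 3) (?bs @ [False, False])) 0)"
      by (auto simp: quoter_simps test_done_def split: if_splits)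
  qed (auto simp: quoter_simps test_done_def cell_def split: if_splits)
  finally show ?thesis by (simp add: unary_def)
qed

lemma replicate_append_unary: "replicate n True @ [True, True, False] = unary (Suc (Suc n))"
  by (induction n) (auto simp: unary_def)

text \<open>The loop invariant: with \<open>xs\<close> processed and \<open>ys\<close> pending, what remains to be generated is the table
  that writes \<open>ys\<close> from cell number \<open>length xs\<close> on. One round of the loop unfolds one equation of
  \<open>writer\<close>.\<close>
lemma quoting:
  "conf 0 (map (cell 1) xs @ map (cell 0) ys @ map (cell 3) bs) \<leadsto>
   conf 27 (map (cell 1) (xs @ ys) @ map (cell 3) (bs @ tm_code (writer (length xs) ys)))"
proof (induction ys arbitrary: xs bs)
  case Nil
  let ?bs = "bs @ unary (2 * length xs) @ unary 0"
  have "conf 0 (map (cell 1) xs @ map (cell 3) bs) \<leadsto> conf 22 (map (cell 1) xs @ map (cell 3) ?bs)"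
    using quoting_entry_start [of xs "[]" bs] by simp
  also have "\<dots> \<leadsto> conf 27 (map (cell 1) xs @
      map (cell 3) (?bs @ [True, False, False, False, False]))"
    using append_bits [of 22 "[(True, 23), (False, 24), (False, 25), (False, 26), (False, 27)]"
        "map (cell 1) xs" ?bs] by (auto simp: quoter_simps)
  also have "?bs @ [True, False, False, False, False] = bs @ tm_code (writer (length xs) [])"
    by (simp add: tm_code_def unary_def)
  finally show ?case by simp
next
  case (Cons y ys)
  let ?bs = "bs @ unary (2 * length xs) @ unary 0"
  let ?cs = "?bs @ unary (2 * Suc (length xs))"
  let ?ds = "?cs @ unary (cell 0 y) @ unary 2 @ unary 0"
  have "conf 0 (map (cell 1) xs @ map (cell 0) (y # ys) @ map (cell 3) bs) \<leadsto>
      conf 7 (map (cell 1) xs @ map (cell 0) (y # ys) @ map (cell 3) ?bs)"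
    using quoting_entry_start [of xs "y # ys" bs] by simp
  also have "\<dots> \<leadsto> conf 11 (map (cell 1) xs @ map (cell 0) (y # ys) @
      map (cell 3) (?bs @ replicate (2 * length xs) True))"
    by (rule count_pass [OF quoter_simps(8-11)]) simp_all
  also have "\<dots> \<leadsto> conf 14 (map (cell 1) xs @ map (cell 0) (y # ys) @
      map (cell 3) ((?bs @ replicate (2 * length xs) True) @ [True, True, False]))"
    using append_bits [of 11 "[(True, 12), (True, 13), (False, 14)]"
        "map (cell 1) xs @ map (cell 0) (y # ys)" "?bs @ replicate (2 * length xs) True"]
    by (auto simp: quoter_simps)
  also have "(?bs @ replicate (2 * length xs) True) @ [True, True, False] = ?cs"
    by (simp add: replicate_append_unary)
  also have "conf 14 (map (cell 1) xs @ map (cell 0) (y # ys) @ map (cell 3) ?cs) \<leadsto>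
      conf (if y then 15 else 16) (map (cell 1) xs @ cell 1 y # map (cell 0) ys @ map (cell 3) ?cs)"
    unfolding list.map append_Cons
    by (rule sweep_rewrite) (auto simp: quoter_simps mark_next_def cell_def)
  also have "map (cell 1) xs @ cell 1 y # map (cell 0) ys @ map (cell 3) ?cs =
      (map (cell 1) (xs @ [y]) @ map (cell 0) ys) @ map (cell 3) ?cs"
    by simp
  also have "conf (if y then 15 else 16) \<dots> \<leadsto>
      conf 0 ((map (cell 1) (xs @ [y]) @ map (cell 0) ys) @ map (cell 3) ?ds)"
  proof -
    let ?ps = "[(True, 17), (False, 18), (True, 19), (True, 20), (False, 21), (False, 0)] :: (bool \<times> nat) list"
    have ps: "writes 16 ?ps" "writes 15 ((True, 16) # ?ps)"
      by (simp_all add: quoter_simps)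
    have zones: "set (map (cell 1) (xs @ [y]) @ map (cell 0) ys) \<subseteq> {1..8}"
      by simp
    have "conf (if y then 15 else 16) ((map (cell 1) (xs @ [y]) @ map (cell 0) ys) @ map (cell 3) ?cs) \<leadsto>
      conf 0 ((map (cell 1) (xs @ [y]) @ map (cell 0) ys) @
        map (cell 3) (?cs @ (if y then [True] else []) @ map fst ?ps))"
      using append_bits [OF ps(1) zones, of ?cs] append_bits [OF ps(2) zones, of ?cs]
      by (cases y) simp_all
    moreover have "(if y then [True] else []) @ map fst ?ps = unary (cell 0 y) @ unary 2 @ unary 0"
      by (simp add: unary_def cell_def numeral_2_eq_2)
    ultimately show ?thesis by (simp only: append_assoc)
  qed
  also have "\<dots> \<leadsto> conf 27 (map (cell 1) ((xs @ [y]) @ ys) @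
      map (cell 3) (?ds @ tm_code (writer (length (xs @ [y])) ys)))"
    using Cons.IH [of "xs @ [y]" ?ds] by simp
  also have "?ds @ tm_code (writer (length (xs @ [y])) ys) =
      bs @ tm_code (writer (length xs) (y # ys))"
    by (simp add: tm_code_def)
  finally show ?case by simp
qed

lemma erasing:
  assumes "k \<in> {1..3}" "set zs \<subseteq> {1..8}"
  shows "conf 27 (map (cell 0) us @ map (cell k) vs @ zs) \<leadsto> conf 27 (map (cell 0) (us @ vs) @ zs)"
proof (induction vs arbitrary: us)
  case Nil
  then show ?case by simp
next
  case (Cons v vs)
  have "conf 27 (map (cell 0) us @ cell k v # map (cell k) vs @ zs) \<leadsto>
      conf 27 (map (cell 0) us @ cell 0 v # map (cell k) vs @ zs)"
    by (rule sweep_rewrite) (use assms in \<open>auto simp: quoter_simps erase_marks_def cell_def\<close>)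
  also have "\<dots> \<leadsto> conf 27 (map (cell 0) ((us @ [v]) @ vs) @ zs)"
    using Cons.IH [of "us @ [v]"] by simp
  finally show ?case by simp
qed

lemma quoting_program:
  "conf 0 (map (cell 0) w) \<leadsto> conf 28 (map (cell 0) (w @ tm_code (writer 0 w)))"
proof -
  let ?v = "tm_code (writer 0 w)"
  have "conf 0 (map (cell 0) w) \<leadsto> conf 27 (map (cell 1) w @ map (cell 3) ?v)"
    using quoting [of "[]" w "[]"] by simp
  also have "\<dots> \<leadsto> conf 27 (map (cell 0) w @ map (cell 3) ?v)"
    using erasing [of 1 "map (cell 3) ?v" "[]" w] by (simp add: image_subset_iff)
  also have "\<dots> \<leadsto> conf 27 (map (cell 0) (w @ ?v))"
    using erasing [of 3 "[]" w ?v] by simp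
  also have "\<dots> \<leadsto> conf 28 (map (cell 0) (w @ ?v))"
  proof -
    have "conf 27 (map (cell 0) (w @ ?v) @ []) \<leadsto> conf 28 (map (cell 0) (w @ ?v) @ [])"
      by (rule sweep_keep)
         (auto simp: quoter_simps erase_marks_def cell_def tape_of_outside split: if_splits)
    then show ?thesis by simp
  qed
  finally show ?thesis .
qed

lemma writing:
  assumes "\<And>k v. (k, v) \<in> set (writer (length xs) ys) \<Longrightarrow> map_of (diagonal D) k = Some v"
  shows "silent (2 * length xs) (int (length xs)) (tape_of (map (cell 0) xs)) \<leadsto>
    silent 1 (int (length (xs @ ys)) - 1) (tape_of (map (cell 0) (xs @ ys)))"
  using assms
proof (induction ys arbitrary: xs)
  case Nil
  have "map_of (diagonal D) (2 * length xs, 0) = Some (1, 0, Left, Silent)"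
    using Nil.prems by simp
  then show ?case
    by - (rule silent_step [where q' = 1 and a = 0 and d = Left],
          use tape_of_blank [of "map (cell 0) xs"] in \<open>auto simp: tape_of_outside\<close>)
next
  case (Cons y ys)
  have "map_of (diagonal D) (2 * length xs, 0) = Some (2 * Suc (length xs), cell 0 y, Right, Silent)"
    using Cons.prems by simp
  moreover have "silent (2 * length (xs @ [y])) (int (length (xs @ [y]))) (tape_of (map (cell 0) (xs @ [y]))) \<leadsto>
    silent 1 (int (length ((xs @ [y]) @ ys)) - 1) (tape_of (map (cell 0) ((xs @ [y]) @ ys)))"
    using Cons.prems by (intro Cons.IH) auto
  moreover have "(tape_of (map (cell 0) xs))(int (length xs) := cell 0 y) =
      tape_of (map (cell 0) (xs @ [y]))"
    using tape_of_extend [of "map (cell 0) xs"] by simp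
  ultimately show ?case
    by - (rule silent_step [where q' = "2 * Suc (length xs)" and a = "cell 0 y" and d = Right],
          simp_all add: tape_of_outside add.commute)
qed

text \<open>The fixed point: the word that the program is started on is the description of the very core that
  contains the program.\<close>
lemma self_description:
  "initial [] \<leadsto> conf 28 (map (cell 0) (tm_code (diagonal D)))"
proof -
  let ?w = "tm_code (core D)"
  have "map_of (diagonal D) k = Some v" if "(k, v) \<in> set (writer 0 ?w)" for k v
    using that turing_machine_diagonal [OF machine]
    by (intro map_of_is_SomeI) (auto simp: turing_machine_def diagonal_def)
  then have "initial [] \<leadsto> silent (4 * 0 + 1) (int (length ?w) - 1) (tape_of (map (cell 0) ?w))"
    using writing [of "[]" ?w] by (simp add: initial_def input_tape_eq_tape_of)
  also have "\<dots> \<leadsto> conf 0 (map (cell 0) ?w)"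
    by (rule return_to_start) auto
  also have "\<dots> \<leadsto> conf 28 (map (cell 0) (?w @ tm_code (writer 0 ?w)))"
    by (rule quoting_program)
  also have "?w @ tm_code (writer 0 ?w) = tm_code (diagonal D)"
    by (simp add: diagonal_def tm_code_def)
  finally show ?thesis .
qed

section \<open>Simulating the decider\<close>

definition simulated :: "config \<Rightarrow> config" where
  "simulated c = silent (decider_state (state c)) (pos c) (tape c)"

lemma simulated_step: "simulated c \<leadsto> simulated (step D c)"
proof (cases "applicable D c")
  case None
  then show ?thesis by (simp add: step_def)
next
  case (Some x)
  obtain q a d e where x: "x = (q, a, d, e)" by (cases x)
  have "((state c, tape c (pos c)), x) \<in> set D"
    using Some by (simp add: applicable_def map_of_SomeD)
  then have "((decider_state (state c), tape c (pos c)), (decider_state q, a, d, Silent))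
      \<in> set (core D)"
    unfolding core_def decider_entries_def x by force
  then have "map_of (diagonal D) (decider_state (state c), tape c (pos c)) =
      Some (decider_state q, a, d, Silent)"
    by (rule core_lookup [OF machine])
  moreover have "simulated (step D c) =
      silent (decider_state q) (shift d (pos c)) ((tape c)(pos c := a))"
    using Some x by (simp add: simulated_def step_def emit_keeps)
  ultimately show ?thesis
    unfolding simulated_def [of c] by - (rule silent_step, auto)
qed

lemma simulated_run: "simulated c \<leadsto> simulated ((step D ^^ t) c)"
  by (induction t) (auto intro: reaches_trans simulated_step)

lemma start_of_simulation: "conf 28 (map (cell 0) w) = simulated (initial w)"
  by (simp add: conf_def simulated_def initial_def decider_state_def input_tape_eq_tape_of)

lemma entry_bound:
  assumes "((q, a), (q', a', d, e)) \<in> set D"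
  shows "q \<le> bound D \<and> q' \<le> bound D \<and> a' \<le> bound D"
proof -
  have "finite ({2} \<union> (\<Union>((q, a), (q', a', d, e)) \<in> set D. {q, q', a'}))"
    by auto
  moreover have "{q, q', a'} \<subseteq> {2} \<union> (\<Union>((q, a), (q', a', d, e)) \<in> set D. {q, q', a'})"
    using assms by fastforce
  ultimately show ?thesis
    unfolding bound_def by (meson Max_ge insert_subset)
qed

lemma two_le_bound: "2 \<le> bound D"
  unfolding bound_def by (rule Max_ge) auto

text \<open>Only finitely many rejecting entries are available, so the situations in which \<open>D\<close> can halt
  have to be bounded in advance.\<close>
lemma run_bounded: "state (run D w t) \<le> bound D \<and> (\<forall>i. tape (run D w t) i \<le> bound D)"
proof (induction t)
  case 0
  show ?case
    using two_le_bound by (auto simp: run_def initial_def input_tape_def)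
next
  case (Suc t)
  show ?case
  proof (cases "applicable D (run D w t)")
    case None
    then show ?thesis using Suc by (simp add: run_def step_def)
  next
    case (Some x)
    obtain q a d e where x: "x = (q, a, d, e)" by (cases x)
    have "((state (run D w t), tape (run D w t) (pos (run D w t))), (q, a, d, e)) \<in> set D"
      using Some by (simp add: applicable_def x map_of_SomeD)
    then have "q \<le> bound D" "a \<le> bound D"
      using entry_bound by blast+
    moreover have "state (run D w (Suc t)) = q"
      "tape (run D w (Suc t)) = (tape (run D w t))(pos (run D w t) := a)"
      using Some x by (simp_all add: run_def step_def emit_keeps)
    ultimately show ?thesis
      using Suc by simp
  qed
qed

lemma no_entry:
  assumes "map_of D (q, a) = None" "q = 1 \<or> bound D < q \<or> bound D < a"
  shows "map_of (diagonal D) (decider_state q, a) = None"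
proof -
  have "(decider_state q, a) \<notin> set (map fst return_entries)"
    "(decider_state q, a) \<notin> set (map fst sweep_entries)"
    using key_ranges(1,2) [of "(decider_state q, a)"] by (auto simp: decider_state_def)
  moreover have "(decider_state q, a) \<notin> set (map fst (decider_entries D))"
    using assms(1) unfolding keys_decider
    by (auto simp: decider_state_def map_of_eq_None_iff image_iff)
  moreover have "(decider_state q, a) \<notin> set (map fst (rejection_entries D))"
    using assms(2) unfolding keys_rejection by (auto simp: decider_state_def)
  moreover have "(decider_state q, a) \<notin> set (map fst (writer 0 w))" for w
    using even_keys_writer [of "(decider_state q, a)"] by (auto simp: decider_state_def)
  ultimately have "(decider_state q, a) \<notin> set (map fst (diagonal D))"
    unfolding diagonal_def core_def map_append set_append Un_iff by blast
  then show ?thesis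
    by (simp add: map_of_eq_None_iff)
qed

text \<open>No entry of the machine prints a bit, so the only word it can complete is the empty one. This
  holds whether or not \<open>D\<close> halts, and shows that the machine always enumerates a family on which a
  decider has to answer.\<close>
lemma outputs_diagonal_subset: "outputs (diagonal D) \<subseteq> {[]}"
proof -
  let ?emission = "\<lambda>x :: (nat \<times> nat) \<times> nat \<times> nat \<times> move \<times> emission. snd (snd (snd (snd x)))"
  have writer: "?emission x = Silent" if "x \<in> set (writer i w)" for x i w
    using that by (induction w arbitrary: i) auto
  have core: "?emission x \<in> {Silent, End_Word}" if "x \<in> set (core D)" for x
    using that
    by (auto simp: core_def return_entries_def sweep_entries_def decider_entries_def
        rejection_entries_def split: if_splits option.splits)
  have emission: "?emission x \<in> {Silent, End_Word}" if "x \<in> set (diagonal D)" for x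
  proof -
    from that have "x \<in> set (core D) \<or> x \<in> set (writer 0 (tm_code (core D)))"
      by (simp add: diagonal_def)
    then show ?thesis
      using core writer [of x] by blast
  qed
  have step_emission: "e = Silent \<or> e = End_Word" if "applicable (diagonal D) c = Some (q, a, d, e)" for c q a d e
    using emission [OF map_of_SomeD [OF that [unfolded applicable_def]]] by simp
  have words: "partial (step (diagonal D) c) = [] \<and> printed (step (diagonal D) c) \<subseteq> {[]}"
    if "partial c = [] \<and> printed c \<subseteq> {[]}" for c
  proof (cases "applicable (diagonal D) c")
    case None
    then show ?thesis using that by (simp add: step_def)
  next
    case (Some x)
    obtain q a d e where "x = (q, a, d, e)" by (cases x)
    then show ?thesis using step_emission [of c q a d e] Some that by (auto simp: step_def)
  qed
  have "partial (run (diagonal D) [] t) = [] \<and> printed (run (diagonal D) [] t) \<subseteq> {[]}" for t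
  proof (induction t)
    case 0
    show ?case by (simp add: run_def initial_def)
  next
    case (Suc t)
    show ?case using words [OF Suc] by (simp add: run_def)
  qed
  then show ?thesis
    unfolding outputs_def by blast
qed

lemma outputs_diagonal:
  assumes "applicable D (run D (tm_code (diagonal D)) t) = None"
  shows "outputs (diagonal D) = (if state (run D (tm_code (diagonal D)) t) = 1 then {} else {[]})"
proof -
  define c where "c = run D (tm_code (diagonal D)) t"
  have lookup: "map_of D (state c, tape c (pos c)) = None"
    using assms by (simp add: applicable_def c_def)
  have "initial [] \<leadsto> simulated c"
    using self_description simulated_run
    unfolding start_of_simulation c_def run_def by (rule reaches_trans)
  show ?thesis
  proof (cases "state c = 1")
    case True
    then have "applicable (diagonal D) (simulated c) = None"
      using no_entry [OF lookup] by (simp add: applicable_def simulated_def)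
    then show ?thesis
      using outputs_of_halting_run [OF \<open>initial [] \<leadsto> simulated c\<close>] True
      by (simp add: simulated_def c_def)
  next
    case False
    let ?d = "step (diagonal D) (simulated c)"
    have "state c \<le> bound D" "tape c (pos c) \<le> bound D"
      using run_bounded by (simp_all add: c_def)
    then have "((decider_state (state c), tape c (pos c)),
        (decider_state (Suc (bound D)), tape c (pos c), Stay, End_Word)) \<in> set (core D)"
      using False lookup unfolding core_def rejection_entries_def by force
    then have d: "?d = \<lparr>state = decider_state (Suc (bound D)), pos = pos c, tape = tape c,
        partial = [], printed = {[]}\<rparr>"
      using core_lookup [OF machine] by (simp add: step_def applicable_def simulated_def)
    have "map_of D (Suc (bound D), a) = None" for a
      using entry_bound by (fastforce simp: map_of_eq_None_iff)
    then have "applicable (diagonal D) ?d = None"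
      unfolding d applicable_def using no_entry by simp
    moreover have "initial [] \<leadsto> ?d"
      using \<open>initial [] \<leadsto> simulated c\<close> reaches_step [OF reaches_refl] by (rule reaches_trans)
    ultimately have "outputs (diagonal D) = printed ?d"
      using outputs_of_halting_run by blast
    then have "outputs (diagonal D) = {[]}"
      by (simp only: d config.simps)
    then show ?thesis
      using False by (simp add: c_def)
  qed
qed

end

section \<open>Two families that must be told apart\<close>

lemma abundant_with_empty_graph:
  "K3_abundant {\<lparr>verts = {}, edges = {}\<rparr> :: nat graph}"
proof -
  have "embeddings (\<lparr>verts = {}, edges = {}\<rparr> :: nat graph) G = {\<lambda>_. undefined}" for G :: "nat graph"
    by (auto simp: embeddings_def)
  then have "Emb (\<lparr>verts = {}, edges = {}\<rparr> :: nat graph) G = 1" for G :: "nat graph"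
    by (simp add: Emb_def)
  then show ?thesis
    unfolding K3_abundant_def by (intro exI [of _ 1]) auto
qed

text \<open>Deleting all triangles costs at least one edge for each member of a family of edge-disjoint
  triangles. Such a family is indexed by the pairs \<open>(x, y)\<close> with \<open>x < m\<close> and \<open>y < m\<close>: its triangles have
  the vertices \<open>x\<close>, \<open>m + y\<close> and \<open>2 * m + (x + y)\<close>, any two of which determine \<open>x\<close> and \<open>y\<close>. These are
  \<open>m * m\<close> triangles on \<open>4 * m\<close> vertices.\<close>
lemma complete_graph_far:
  fixes m :: nat
  defines "G \<equiv> \<lparr>verts = {..<4 * m}, edges = {e. e \<subseteq> {..<4 * m} \<and> card e = 2}\<rparr>"
  shows "far_from_triangle_free (1 / 16) G"
  unfolding far_from_triangle_free_def
proof (intro allI impI)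
  fix F assume F: "F \<subseteq> edges G \<and> triangle_free (delete_edges G F)"
  have "finite (edges G)" by (simp add: G_def)
  then have "finite F" using F finite_subset by blast
  define T where "T x y = {{x, m + y}, {m + y, 2 * m + (x + y)}, {x, 2 * m + (x + y)}}" for x y
  define f where "f x y = (SOME e. e \<in> F \<inter> T x y)" for x y
  have "edges (delete_edges G F) = edges G - F"
    by (simp add: delete_edges_def)
  then have kept: "\<not> (distinct [x, y, z] \<and> {x, y} \<in> edges G - F \<and> {y, z} \<in> edges G - F \<and>
      {x, z} \<in> edges G - F)" for x y z
    using F unfolding triangle_free_def by (simp only:) blast
  have "\<exists>e. e \<in> F \<inter> T x y" if "x < m" "y < m" for x y
  proof -
    have "distinct [x, m + y, 2 * m + (x + y)]" using that by auto
    moreover have "T x y \<subseteq> edges G"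
      using that by (auto simp: G_def T_def)
    ultimately show ?thesis
      using kept [of x "m + y" "2 * m + (x + y)"] unfolding T_def by blast
  qed
  then have f: "f x y \<in> F \<inter> T x y" if "x < m" "y < m" for x y
    using someI_ex [of "\<lambda>e. e \<in> F \<inter> T x y"] that unfolding f_def by blast
  have disjoint: "x = x' \<and> y = y'"
    if "e \<in> T x y" "e \<in> T x' y'" "x < m" "y < m" "x' < m" "y' < m" for e x y x' y'
  proof -
    from that(1,2) have "\<exists>e. (e = {x, m + y} \<or> e = {m + y, 2 * m + (x + y)} \<or> e = {x, 2 * m + (x + y)}) \<and>
        (e = {x', m + y'} \<or> e = {m + y', 2 * m + (x' + y')} \<or> e = {x', 2 * m + (x' + y')})"
      unfolding T_def by blast
    then show ?thesis
      using that(3-6) by - (elim exE conjE disjE; auto simp: doubleton_eq_iff)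
  qed
  have "inj_on (\<lambda>(x, y). f x y) ({..<m} \<times> {..<m})"
  proof (rule inj_onI)
    fix p p'
    assume "p \<in> {..<m} \<times> {..<m}" "p' \<in> {..<m} \<times> {..<m}"
      and "(case p of (x, y) \<Rightarrow> f x y) = (case p' of (x, y) \<Rightarrow> f x y)"
    then show "p = p'"
      using f [of "fst p" "snd p"] f [of "fst p'" "snd p'"]
        disjoint [of "f (fst p) (snd p)" "fst p" "snd p" "fst p'" "snd p'"]
      by (cases p; cases p') simp
  qed
  moreover have "(\<lambda>(x, y). f x y) ` ({..<m} \<times> {..<m}) \<subseteq> F"
    using f by auto
  ultimately have "card ({..<m} \<times> {..<m}) \<le> card F"
    using \<open>finite F\<close> by (rule card_inj_on_le)
  then have "real (m * m) \<le> real (card F)"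
    by (simp only: card_cartesian_product card_lessThan of_nat_le_iff)
  then show "real (card F) \<ge> 1 / 16 * real (card (verts G)) ^ 2"
    by (simp add: G_def power2_eq_square)
qed

lemma not_abundant_empty: "\<not> K3_abundant ({} :: nat graph set)"
proof
  assume "K3_abundant ({} :: nat graph set)"
  then obtain n0 where n0: "\<forall>G :: nat graph. \<not> (finite_simple_graph G \<and> card (verts G) \<ge> n0 \<and>
      far_from_triangle_free (1 / 16) G)"
    unfolding K3_abundant_def by fastforce
  let ?G = "\<lparr>verts = {..<4 * n0}, edges = {e. e \<subseteq> {..<4 * n0} \<and> card e = 2}\<rparr>"
  have "finite_simple_graph ?G" "card (verts ?G) \<ge> n0"
    by (auto simp: finite_simple_graph_def)
  then show False
    using n0 complete_graph_far [of n0] by blast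
qed

theorem theorem4p10:
  "\<not> (\<exists>D. turing_machine D \<and> decides_K3_abundance D)"
proof
  assume "\<exists>D. turing_machine D \<and> decides_K3_abundance D"
  then obtain D where D: "turing_machine D" "decides_K3_abundance D" by blast
  interpret diagonalization D by standard (rule D(1))
  let ?w = "tm_code (diagonal D)" and ?O = "\<lparr>verts = {}, edges = {}\<rparr> :: nat graph"
  have decides: "halts D ?w \<and> (accepts D ?w \<longleftrightarrow> K3_abundant \<A>)"
    if "\<forall>H\<in>\<A>. finite_simple_graph H" "enumerates (diagonal D) \<A>" for \<A> :: "nat graph set"
    using D that turing_machine_diagonal unfolding decides_K3_abundance_def by blast
  have none: "enumerates (diagonal D) ({} :: nat graph set)" if "outputs (diagonal D) = {}"
    using that by (simp add: enumerates_def)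
  have "describes [] ?O"
    by (simp add: describes_def adjacency_word_def)
  then have single: "enumerates (diagonal D) {?O}" if "outputs (diagonal D) = {[]}"
    using that by (simp add: enumerates_def)
  \<comment> \<open>The decider has to halt because the machine enumerates one of the two families even without
    any knowledge of what \<open>D\<close> does.\<close>
  have "outputs (diagonal D) = {} \<or> outputs (diagonal D) = {[]}"
    using outputs_diagonal_subset by blast
  then have "halts D ?w"
    using decides [of "{}"] decides [of "{?O}"] none single by (auto simp: finite_simple_graph_def)
  then obtain t where t: "applicable D (run D ?w t) = None"
    by (auto simp: halts_def)
  show False
  proof (cases "state (run D ?w t) = 1")
    case True
    then have "accepts D ?w"
      using t by (auto simp: accepts_def)
    moreover have "outputs (diagonal D) = {}"
      using outputs_diagonal [OF t] True by simp
    ultimately show False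
      using decides [of "{}"] none not_abundant_empty by simp
  next
    case False
    then have "outputs (diagonal D) = {[]}"
      using outputs_diagonal [OF t] by simp
    then have "accepts D ?w"
      using decides [of "{?O}"] single abundant_with_empty_graph
      by (simp add: finite_simple_graph_def)
    then have "state (run D ?w t) = 1"
      using t halted_run_unique by (metis accepts_def)
    then show False
      using False by simp
  qed
qed

end
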